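(* Let $X$ be a compact convex set and let $H$ be an intermediate function space on $X$ determined by extreme points. Then $Z(H)=M(H)$ if and only if $\iota(\operatorname{ext}X)\subset m(S(H))$.
   Context: A compact convex set is a compact convex subset of a (Hausdorff) locally convex real topological vector space; $\operatorname{ext}X$ is the set of its extreme points. $A_c(X)$ is the space of continuous affine real functions on $X$ and $A_b(X)$ the space of bounded affine real functions on $X$, with the supremum norm and pointwise order. An intermediate function space on $X$ is a (norm-)closed linear subspace $H\subset A_b(X)$ with $A_c(X)\subset H$. It is determined by extreme points if $\inf u(\operatorname{ext}X)\le u\le\sup u(\operatorname{ext}X)$ for every $u\in H$. For a partially ordered Banach space $W$, $\mathfrak D(W)$ is the set of bounded linear operators $T:W\to W$ for which there is $\lambda\ge0$ with $-\lambda I\le T\le\lambda I$ (where $T\ge0$ means $Ta\ge0$ for each $a\ge0$). The center of $H$ is $Z(H)=\{T(1_X):T\in\mathfrak D(H)\}$. The space of multipliers is $M(H)=\{u\in H:\forall a\in H\ \exists b\in H\colon b=u\cdot a\text{ on }\operatorname{ext}X\}$. The state space of $H$ is $S(H)=\{\varphi\in H^*:\|\varphi\|\le1,\ \varphi(1_X)=1\}$ with the weak$^*$ topology; it is a compact convex set. The map $\iota:X\to S(H)$ is defined by $\iota(x)(a)=a(x)$, $a\in H$. For a compact convex set $Y$, $$m(Y)=\{y\in Y:\forall T\in\mathfrak D(A_c(Y))\ \forall a\in A_c(Y)\colon T(a)(y)=T(1)(y)\cdot a(y)\}.$$ *)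

theory Defs
  imports "HOL-Analysis.Analysis" "HOL-Library.Function_Algebras"
begin

section \<open>Locally convex Hausdorff real topological vector spaces\<close>

class locally_convex_tvs = real_vector + topological_ab_group_add + t2_space +
  assumes tendsto_scaleR_Pair:
    "LIM p (nhds r \<times>\<^sub>F nhds x). fst p *\<^sub>R snd p :> nhds (r *\<^sub>R x)"
  and locally_convex:
    "open U \<Longrightarrow> 0 \<in> U \<Longrightarrow> \<exists>V. open V \<and> 0 \<in> V \<and> V \<subseteq> U \<and>
       (\<forall>x\<in>V. \<forall>y\<in>V. \<forall>s\<ge>0. \<forall>t\<ge>0. s + t = 1 \<longrightarrow> s *\<^sub>R x + t *\<^sub>R y \<in> V)"

lemma locally_convex_tvs_convex_nhd:
  fixes U :: "'a::locally_convex_tvs set"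
  assumes "open U" "0 \<in> U"
  shows "\<exists>V. open V \<and> 0 \<in> V \<and> V \<subseteq> U \<and> convex V"
  using locally_convex[OF assms] unfolding convex_def .

instance real_normed_vector \<subseteq> locally_convex_tvs
proof
  fix r :: real and x :: 'a
  have "((\<lambda>p. fst p *\<^sub>R snd p) \<longlongrightarrow> r *\<^sub>R x) (nhds r \<times>\<^sub>F nhds x)"
    by (rule tendsto_scaleR[OF filterlim_fst filterlim_snd])
  then show "LIM p (nhds r \<times>\<^sub>F nhds x). fst p *\<^sub>R snd p :> nhds (r *\<^sub>R x)" .
next
  fix U :: "'a set"
  assume "open U" "0 \<in> U"
  then obtain e where "e > 0" "ball 0 e \<subseteq> U"
    by (meson openE)
  then have "\<exists>V. open V \<and> 0 \<in> V \<and> V \<subseteq> U \<and> convex V"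
    by (intro exI[of _ "ball 0 e"]) auto
  then show "\<exists>V. open V \<and> 0 \<in> V \<and> V \<subseteq> U \<and>
      (\<forall>x\<in>V. \<forall>y\<in>V. \<forall>s\<ge>0. \<forall>t\<ge>0. s + t = 1 \<longrightarrow> s *\<^sub>R x + t *\<^sub>R y \<in> V)"
    unfolding convex_def .
qed

text \<open>Function spaces carry the pointwise vector structure and, from the library, the
  topology of pointwise convergence. The weak* topology on a dual is a subspace topology of it.\<close>

instantiation "fun" :: (type, real_vector) real_vector
begin

definition scaleR_fun :: "real \<Rightarrow> ('a \<Rightarrow> 'b) \<Rightarrow> 'a \<Rightarrow> 'b" where
  "scaleR_fun r f = (\<lambda>x. r *\<^sub>R f x)"

instance
  by standard (auto simp: scaleR_fun_def plus_fun_def fun_eq_iff algebra_simps)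

end

lemma tendsto_funI:
  fixes f :: "'c \<Rightarrow> 'a \<Rightarrow> 'b::topological_space"
  assumes "\<And>i. ((\<lambda>c. f c i) \<longlongrightarrow> g i) F"
  shows "(f \<longlongrightarrow> g) F"
proof -
  have "limitin (product_topology (\<lambda>_. euclidean) UNIV) f g F"
    using assms by (auto simp: limitin_componentwise)
  then show ?thesis
    by (simp add: euclidean_product_topology)
qed

lemma tendsto_funD:
  fixes f :: "'c \<Rightarrow> 'a \<Rightarrow> 'b::topological_space"
  assumes "(f \<longlongrightarrow> g) F"
  shows "((\<lambda>c. f c i) \<longlongrightarrow> g i) F"
proof -
  have "limitin (product_topology (\<lambda>_. euclidean) UNIV) f g F"
    using assms by (simp add: euclidean_product_topology)
  then show ?thesis
    by (auto simp: limitin_componentwise)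
qed

lemma open_vimage_coordinate:
  fixes U :: "'b::topological_space set"
  assumes "open U"
  shows "open ((\<lambda>h::'a \<Rightarrow> 'b. h i) -` U)"
proof -
  have "continuous_on UNIV (\<lambda>h::'a \<Rightarrow> 'b. h i)" by simp
  with assms show ?thesis by (rule open_vimage)
qed

instance "fun" :: (type, t0_space) t0_space
proof
  fix f g :: "'a \<Rightarrow> 'b"
  assume "f \<noteq> g"
  then obtain i where "f i \<noteq> g i" by auto
  then obtain U where "open U" "\<not> (f i \<in> U \<longleftrightarrow> g i \<in> U)"
    using separation_t0[of "f i" "g i"] by auto
  then show "\<exists>U. open U \<and> \<not> (f \<in> U \<longleftrightarrow> g \<in> U)"
    by (intro exI[of _ "(\<lambda>h. h i) -` U"]) (auto intro: open_vimage_coordinate)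
qed

instance "fun" :: (type, t1_space) t1_space
proof
  fix f g :: "'a \<Rightarrow> 'b"
  assume "f \<noteq> g"
  then obtain i where "f i \<noteq> g i" by auto
  then obtain U where "open U" "f i \<in> U" "g i \<notin> U"
    by (meson t1_space)
  then show "\<exists>U. open U \<and> f \<in> U \<and> g \<notin> U"
    by (intro exI[of _ "(\<lambda>h. h i) -` U"]) (auto intro: open_vimage_coordinate)
qed

instance "fun" :: (type, t2_space) t2_space
proof
  fix f g :: "'a \<Rightarrow> 'b"
  assume "f \<noteq> g"
  then obtain i where "f i \<noteq> g i" by auto
  then obtain U V where UV: "open U" "open V" "f i \<in> U" "g i \<in> V" "U \<inter> V = {}"
    by (meson hausdorff)
  show "\<exists>U V. open U \<and> open V \<and> f \<in> U \<and> g \<in> V \<and> U \<inter> V = {}"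
    using UV by (intro exI[of _ "(\<lambda>h. h i) -` U"] exI[of _ "(\<lambda>h. h i) -` V"])
       (auto intro: open_vimage_coordinate)
qed

instance "fun" :: (type, topological_monoid_add) topological_monoid_add
proof
  fix a b :: "'a \<Rightarrow> 'b"
  show "LIM x (nhds a \<times>\<^sub>F nhds b). fst x + snd x :> nhds (a + b)"
  proof (rule tendsto_funI)
    fix i
    have "((\<lambda>x. fst x i) \<longlongrightarrow> a i) (nhds a \<times>\<^sub>F nhds b)"
      by (rule tendsto_funD[OF filterlim_fst])
    moreover have "((\<lambda>x. snd x i) \<longlongrightarrow> b i) (nhds a \<times>\<^sub>F nhds b)"
      by (rule tendsto_funD[OF filterlim_snd])
    ultimately show "((\<lambda>x. (fst x + snd x) i) \<longlongrightarrow> (a + b) i) (nhds a \<times>\<^sub>F nhds b)"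
      unfolding plus_fun_def by (rule tendsto_add)
  qed
qed

instance "fun" :: (type, topological_group_add) topological_group_add
proof
  fix a :: "'a \<Rightarrow> 'b"
  show "(uminus \<longlongrightarrow> - a) (nhds a)"
  proof (rule tendsto_funI)
    fix i
    have "((\<lambda>x. x i) \<longlongrightarrow> a i) (nhds a)"
      by (rule tendsto_funD[OF filterlim_ident])
    then show "((\<lambda>x. (- x) i) \<longlongrightarrow> (- a) i) (nhds a)"
      unfolding fun_Compl_def by (rule tendsto_minus)
  qed
qed

instance "fun" :: (type, topological_ab_group_add) topological_ab_group_add ..

instance "fun" :: (type, locally_convex_tvs) locally_convex_tvs
proof
  fix r :: real and f :: "'a \<Rightarrow> 'b"
  show "LIM p (nhds r \<times>\<^sub>F nhds f). fst p *\<^sub>R snd p :> nhds (r *\<^sub>R f)"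
  proof (rule tendsto_funI)
    fix i
    have "LIM p (nhds r \<times>\<^sub>F nhds f). (fst p, snd p i) :> (nhds r \<times>\<^sub>F nhds (f i))"
      by (rule filterlim_Pair[OF filterlim_fst tendsto_funD[OF filterlim_snd]])
    from filterlim_compose[OF tendsto_scaleR_Pair this]
    show "((\<lambda>p. (fst p *\<^sub>R snd p) i) \<longlongrightarrow> (r *\<^sub>R f) i) (nhds r \<times>\<^sub>F nhds f)"
      by (simp add: scaleR_fun_def)
  qed
next
  fix U :: "('a \<Rightarrow> 'b) set"
  assume U: "open U" "0 \<in> U"
  have "openin (product_topology (\<lambda>_. euclidean) UNIV) U"
    using U by (simp add: euclidean_product_topology)
  from product_topology_open_contains_basis[OF this U(2)] obtain W where W:
    "0 \<in> Pi\<^sub>E UNIV W" "\<And>i. open (W i)" "finite {i. W i \<noteq> UNIV}" "Pi\<^sub>E UNIV W \<subseteq> U"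
    by auto
  have "\<exists>V. open V \<and> 0 \<in> V \<and> convex V \<and> V \<subseteq> W i \<and> (W i = UNIV \<longrightarrow> V = UNIV)" for i
  proof (cases "W i = UNIV")
    case False
    have "0 \<in> W i" using W(1) by (simp add: PiE_UNIV_domain Pi_iff zero_fun_def)
    with False show ?thesis using locally_convex_tvs_convex_nhd[OF W(2)] by blast
  qed auto
  then obtain V where V: "\<And>i. open (V i)" "\<And>i. 0 \<in> V i" "\<And>i. convex (V i)"
    "\<And>i. V i \<subseteq> W i" "\<And>i. W i = UNIV \<Longrightarrow> V i = UNIV"
    by metis
  have "finite {i. V i \<noteq> UNIV}"
    by (rule finite_subset[OF _ W(3)]) (use V(5) in auto)
  then have "open (Pi\<^sub>E UNIV V)" using V(1) by (intro open_PiE) auto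
  moreover have "0 \<in> Pi\<^sub>E UNIV V" using V(2) by (simp add: PiE_UNIV_domain zero_fun_def)
  moreover have "convex (Pi\<^sub>E UNIV V)"
  proof (rule convexI)
    fix f g and s t :: real
    assume "f \<in> Pi\<^sub>E UNIV V" "g \<in> Pi\<^sub>E UNIV V" "0 \<le> s" "0 \<le> t" "s + t = 1"
    then show "s *\<^sub>R f + t *\<^sub>R g \<in> Pi\<^sub>E UNIV V"
      by (simp add: PiE_UNIV_domain Pi_iff plus_fun_def scaleR_fun_def convexD[OF V(3)])
  qed
  moreover have "Pi\<^sub>E UNIV V \<subseteq> U"
    by (rule subset_trans[OF PiE_mono W(4)]) (rule V(4))
  ultimately have "\<exists>V. open V \<and> 0 \<in> V \<and> V \<subseteq> U \<and> convex V"
    by (intro exI[of _ "Pi\<^sub>E UNIV V"] conjI)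
  then show "\<exists>V. open V \<and> 0 \<in> V \<and> V \<subseteq> U \<and>
      (\<forall>x\<in>V. \<forall>y\<in>V. \<forall>s\<ge>0. \<forall>t\<ge>0. s + t = 1 \<longrightarrow> s *\<^sub>R x + t *\<^sub>R y \<in> V)"
    unfolding convex_def .
qed

section \<open>Function spaces on a compact convex set\<close>

definition compact_convex :: "'a::locally_convex_tvs set \<Rightarrow> bool" where
  "compact_convex X \<longleftrightarrow> compact X \<and> convex X"

definition ext :: "'a::real_vector set \<Rightarrow> 'a set" where
  "ext X = {x. x extreme_point_of X}"

text \<open>A real function on \<open>X\<close> is represented by its extension by \<open>0\<close> to the whole type. Then
  equality, the vector space operations and the order of the function type are those of functions
  on \<open>X\<close>, and the constant function \<open>1\<close> on \<open>X\<close> is \<open>indicator X\<close>.\<close>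

definition affine_functions :: "'a::real_vector set \<Rightarrow> ('a \<Rightarrow> real) set" where
  "affine_functions X = {f.
     (\<forall>x\<in>X. \<forall>y\<in>X. \<forall>t\<in>{0..1}. f ((1 - t) *\<^sub>R x + t *\<^sub>R y) = (1 - t) * f x + t * f y) \<and>
     (\<forall>x. x \<notin> X \<longrightarrow> f x = 0)}"

definition A_c :: "'a::locally_convex_tvs set \<Rightarrow> ('a \<Rightarrow> real) set" where
  "A_c X = {f \<in> affine_functions X. continuous_on X f}"

definition A_b :: "'a::locally_convex_tvs set \<Rightarrow> ('a \<Rightarrow> real) set" where
  "A_b X = {f \<in> affine_functions X. bounded (f ` X)}"

definition sup_norm :: "'a set \<Rightarrow> ('a \<Rightarrow> real) \<Rightarrow> real" where
  "sup_norm X f = (SUP x\<in>X. \<bar>f x\<bar>)"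

definition intermediate_function_space ::
    "'a::locally_convex_tvs set \<Rightarrow> ('a \<Rightarrow> real) set \<Rightarrow> bool" where
  "intermediate_function_space X H \<longleftrightarrow>
     subspace H \<and> A_c X \<subseteq> H \<and> H \<subseteq> A_b X \<and>
     (\<forall>u\<in>A_b X. (\<forall>e>0. \<exists>v\<in>H. sup_norm X (u - v) < e) \<longrightarrow> u \<in> H)"

definition determined_by_extreme_points ::
    "'a::locally_convex_tvs set \<Rightarrow> ('a \<Rightarrow> real) set \<Rightarrow> bool" where
  "determined_by_extreme_points X H \<longleftrightarrow>
     (\<forall>u\<in>H. \<forall>x\<in>X. Inf (u ` ext X) \<le> u x \<and> u x \<le> Sup (u ` ext X))"

section \<open>The center and the multipliers\<close>

definition linear_map_on :: "'w::real_vector set \<Rightarrow> ('w \<Rightarrow> 'v::real_vector) \<Rightarrow> bool" where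
  "linear_map_on W T \<longleftrightarrow>
     (\<forall>a\<in>W. \<forall>b\<in>W. T (a + b) = T a + T b) \<and> (\<forall>a\<in>W. \<forall>r. T (r *\<^sub>R a) = r *\<^sub>R T a)"

definition nonneg_operator :: "'w::{real_vector, ord} set \<Rightarrow> ('w \<Rightarrow> 'w) \<Rightarrow> bool" where
  "nonneg_operator W T \<longleftrightarrow> (\<forall>a\<in>W. 0 \<le> a \<longrightarrow> 0 \<le> T a)"

text \<open>The partially ordered Banach space is the subspace \<open>W\<close> of the ambient type, normed by \<open>N\<close>.
  The operators are total functions of which only the restriction to \<open>W\<close> matters.\<close>

definition center_operators ::
    "('w \<Rightarrow> real) \<Rightarrow> 'w::{real_vector, ord} set \<Rightarrow> ('w \<Rightarrow> 'w) set" where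
  "center_operators N W = {T.
     T ` W \<subseteq> W \<and> linear_map_on W T \<and> (\<exists>B. \<forall>a\<in>W. N (T a) \<le> B * N a) \<and>
     (\<exists>l::real. 0 \<le> l \<and> nonneg_operator W (\<lambda>a. T a + l *\<^sub>R a) \<and>
                        nonneg_operator W (\<lambda>a. l *\<^sub>R a - T a))}"

definition center :: "'a::locally_convex_tvs set \<Rightarrow> ('a \<Rightarrow> real) set \<Rightarrow> ('a \<Rightarrow> real) set" where
  "center X H = {T (indicator X) | T. T \<in> center_operators (sup_norm X) H}"

definition multipliers ::
    "'a::locally_convex_tvs set \<Rightarrow> ('a \<Rightarrow> real) set \<Rightarrow> ('a \<Rightarrow> real) set" where
  "multipliers X H = {u \<in> H. \<forall>a\<in>H. \<exists>b\<in>H. \<forall>x\<in>ext X. b x = u x * a x}"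

definition m_set :: "'b::locally_convex_tvs set \<Rightarrow> 'b set" where
  "m_set Y = {y \<in> Y. \<forall>T\<in>center_operators (sup_norm Y) (A_c Y). \<forall>a\<in>A_c Y.
                T a y = T (indicator Y) y * a y}"

section \<open>The state space\<close>

text \<open>A functional on \<open>H\<close> is likewise represented by its extension by \<open>0\<close>. The topology of the
  function type then restricts to the topology of pointwise convergence on \<open>H\<close>, that is, to the
  weak* topology.\<close>

definition dual_space ::
    "'a set \<Rightarrow> ('a \<Rightarrow> real) set \<Rightarrow> (('a \<Rightarrow> real) \<Rightarrow> real) set" where
  "dual_space X H = {\<phi>. linear_map_on H \<phi> \<and> (\<exists>B. \<forall>a\<in>H. \<bar>\<phi> a\<bar> \<le> B * sup_norm X a) \<and>
                        (\<forall>a. a \<notin> H \<longrightarrow> \<phi> a = 0)}"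

definition dual_norm :: "'a set \<Rightarrow> ('a \<Rightarrow> real) set \<Rightarrow> (('a \<Rightarrow> real) \<Rightarrow> real) \<Rightarrow> real" where
  "dual_norm X H \<phi> = Sup {\<bar>\<phi> a\<bar> | a. a \<in> H \<and> sup_norm X a \<le> 1}"

definition state_space ::
    "'a set \<Rightarrow> ('a \<Rightarrow> real) set \<Rightarrow> (('a \<Rightarrow> real) \<Rightarrow> real) set" where
  "state_space X H = {\<phi> \<in> dual_space X H. dual_norm X H \<phi> \<le> 1 \<and> \<phi> (indicator X) = 1}"

definition evaluation :: "('a \<Rightarrow> real) set \<Rightarrow> 'a \<Rightarrow> ('a \<Rightarrow> real) \<Rightarrow> real" where
  "evaluation H x = (\<lambda>a. if a \<in> H then a x else 0)"

end

theory Submission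
  imports Defs
begin

text \<open>Evaluation identifies \<open>H\<close>, as an ordered normed space, with \<open>A\<^sub>c(S(H))\<close>: surjectivity holds
  because a continuous affine function on the compact set \<open>S(H)\<close> almost depends on finitely many
  coordinates only, hence is uniformly close to a combination of them, and \<open>H\<close> is closed. This
  conjugates \<open>D(H)\<close> to \<open>D(A\<^sub>c(S(H)))\<close>. If \<open>\<iota>(ext X) \<subseteq> m(S(H))\<close>, then every \<open>T \<in> D(H)\<close> acts on
  \<open>ext X\<close> as multiplication by \<open>T(1)\<close>, so \<open>T(1)\<close> is a multiplier. Conversely a multiplier \<open>u\<close> induces
  an operator \<open>U \<in> D(H)\<close> with \<open>U(1) = u\<close>, because \<open>H\<close> is determined by extreme points, and an
  operator in \<open>D(H)\<close> is determined by its value at \<open>1\<close>. The latter uses no extreme states: if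
  \<open>R(1) = 0\<close> and \<open>-r I \<le> R \<le> r I\<close>, then \<open>P = I + R/r\<close> and \<open>Q = I - R/r\<close> are positive contractions
  with mean \<open>I\<close>, and boundedness of all products of their powers forces \<open>P = Q\<close>.\<close>

section \<open>Harmonic functions and affine approximation\<close>

text \<open>The Choquet--Deny argument: where the increment \<open>d\<close> is almost maximal, harmonicity keeps it
  almost maximal along a long antidiagonal, over which it telescopes to a difference of two values
  of \<open>v\<close>.\<close>
lemma bounded_harmonic_le:
  fixes v :: "nat \<Rightarrow> nat \<Rightarrow> real"
  assumes harmonic: "\<And>i j. v i j = (v (Suc i) j + v i (Suc j)) / 2"
    and bounded: "\<And>i j. \<bar>v i j\<bar> \<le> M"
  shows "v (Suc p) q \<le> v p (Suc q)"
proof (rule ccontr)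
  define d where "d i j = v (Suc i) j - v i (Suc j)" for i j
  define D where "D = (SUP (i, j). d i j)"
  have d_harmonic: "d i j = (d (Suc i) j + d i (Suc j)) / 2" for i j
    using harmonic[of "Suc i" j] harmonic[of i "Suc j"] by (simp add: d_def)
  have "d i j \<le> 2 * M" for i j
    using bounded[of "Suc i" j] bounded[of i "Suc j"] unfolding d_def by linarith
  then have bdd: "bdd_above (range (\<lambda>(i, j). d i j))"
    by (auto intro!: bdd_aboveI[of _ "2 * M"])
  have d_le: "d i j \<le> D" for i j
    unfolding D_def using cSUP_upper[OF _ bdd, of "(i, j)"] by simp
  assume "\<not> v (Suc p) q \<le> v p (Suc q)"
  then have "0 < D" using d_le[of p q] by (simp add: d_def)
  \<comment> \<open>A total of \<open>n * (D / 2)\<close> will exceed \<open>2 * M\<close>, which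
    bounds the difference of any two values of \<open>v\<close>.\<close>
  obtain n :: nat where n: "4 * M < n * D"
    using reals_Archimedean3[OF \<open>0 < D\<close>] by blast
  \<comment> \<open>Makes \<open>2 ^ n * \<eta>\<close> equal to \<open>D / 2\<close>, so increments
    at most \<open>n\<close> steps away from the start remain at least \<open>D / 2\<close>.\<close>
  define \<eta> where "\<eta> = D / 2 ^ Suc n"
  have "0 < \<eta>" using \<open>0 < D\<close> by (simp add: \<eta>_def)
  then have "D - \<eta> < D" by simp
  then obtain i j where ij: "D - \<eta> < d i j"
    unfolding D_def using less_cSUP_iff[OF _ bdd] by auto
  \<comment> \<open>The deficit from \<open>D\<close> at most doubles with each step:
    \<open>d\<close> is the mean of its two successors, and \<open>D\<close> bounds the other
    one.\<close>
  have i_dir: "D - 2 ^ k * \<eta> \<le> d (i + k) j" for k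
  proof (induction k)
    case (Suc k)
    then show ?case using d_harmonic[of "i + k" j] d_le[of "i + k" "Suc j"] by simp
  qed (use ij in simp)
  have d_ge: "D - 2 ^ (k + l) * \<eta> \<le> d (i + k) (j + l)" for k l
  proof (induction l)
    case (Suc l)
    then show ?case using d_harmonic[of "i + k" "j + l"] d_le[of "Suc (i + k)" "j + l"] by simp
  qed (use i_dir in simp)
  \<comment> \<open>The sum \<open>m + l\<close>, hence the bound on the deficit, is constant along
    an antidiagonal; the induction therefore trades one unit of \<open>m\<close> for one of
    \<open>l\<close>.\<close>
  have "m * (D - 2 ^ (m + l) * \<eta>) \<le> v (i + m) (j + l) - v i (j + l + m)" for m l
  proof (induction m arbitrary: l)
    case (Suc m)
    have "D - 2 ^ (Suc m + l) * \<eta> \<le> D - 2 ^ (m + l) * \<eta>" using \<open>0 < \<eta>\<close> by simp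
    also have "\<dots> \<le> v (Suc (i + m)) (j + l) - v (i + m) (Suc (j + l))"
      using d_ge[of m l] by (simp add: d_def)
    finally show ?case using Suc[of "Suc l"] by (simp add: algebra_simps)
  qed simp
  from this[of n 0] have "n * D / 2 \<le> v (i + n) j - v i (j + n)"
    by (simp add: \<eta>_def)
  then show False using bounded[of "i + n" j] bounded[of i "j + n"] n by linarith
qed

text \<open>The hypotheses are symmetric in the two indices, so the inequality for the transposed
  function is the reverse inequality.\<close>

lemma bounded_harmonic_eq:
  fixes v :: "nat \<Rightarrow> nat \<Rightarrow> real"
  assumes "\<And>i j. v i j = (v (Suc i) j + v i (Suc j)) / 2" "\<And>i j. \<bar>v i j\<bar> \<le> M"
  shows "v (Suc p) q = v p (Suc q)"
proof (rule antisym)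
  show "v (Suc p) q \<le> v p (Suc q)" using assms by (rule bounded_harmonic_le)
  show "v p (Suc q) \<le> v (Suc p) q"
  proof (rule bounded_harmonic_le[of "\<lambda>i j. v j i"])
    show "v j i = (v j (Suc i) + v (Suc j) i) / 2" for i j
      using assms(1)[of j i] by argo
  qed (rule assms(2))
qed

text \<open>The affinity clause of \<open>affine_functions\<close> alone: coordinate functions of
  states do not vanish outside the state space.\<close>

definition affine_on :: "'b::real_vector set \<Rightarrow> ('b \<Rightarrow> real) \<Rightarrow> bool" where
  "affine_on S f \<longleftrightarrow>
     (\<forall>x\<in>S. \<forall>y\<in>S. \<forall>t\<in>{0..1}. f ((1 - t) *\<^sub>R x + t *\<^sub>R y) = (1 - t) * f x + t * f y)"

lemma affine_on_diff_mult:
  assumes "affine_on S f" "affine_on S g"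
  shows "affine_on S (\<lambda>x. f x - r * g x)"
  unfolding affine_on_def
proof (intro ballI)
  fix x y t assume "x \<in> S" "y \<in> S" "t \<in> {0..1::real}"
  then have "f ((1 - t) *\<^sub>R x + t *\<^sub>R y) = (1 - t) * f x + t * f y"
    "g ((1 - t) *\<^sub>R x + t *\<^sub>R y) = (1 - t) * g x + t * g y"
    using assms by (auto simp: affine_on_def)
  then show "f ((1 - t) *\<^sub>R x + t *\<^sub>R y) - r * g ((1 - t) *\<^sub>R x + t *\<^sub>R y) =
      (1 - t) * (f x - r * g x) + t * (f y - r * g y)"
    by (simp only:) (simp add: algebra_simps)
qed

text \<open>A convex substitute for Hahn--Banach extension from a subspace of finite codimension.\<close>
lemma affine_approximation:
  fixes S :: "'b::real_vector set" and g :: "'i \<Rightarrow> 'b \<Rightarrow> real"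
  assumes "finite I" "convex S" "S \<noteq> {}" "affine_on S f" "\<And>i. i \<in> I \<Longrightarrow> affine_on S (g i)"
    and "\<And>x y. x \<in> S \<Longrightarrow> y \<in> S \<Longrightarrow> (\<And>i. i \<in> I \<Longrightarrow> g i x = g i y) \<Longrightarrow> \<bar>f x - f y\<bar> \<le> e"
  shows "\<exists>c k. \<forall>x\<in>S. \<bar>f x - (k + (\<Sum>i\<in>I. c i * g i x))\<bar> \<le> e"
  using assms(1,4-)
proof (induction I arbitrary: f rule: finite_induct)
  case empty
  obtain z where "z \<in> S" using \<open>S \<noteq> {}\<close> by blast
  with empty show ?case by (intro exI[of _ "f z"] exI) auto
next
  case (insert j I)
  define P where "P = {(x, y). x \<in> S \<and> y \<in> S \<and> (\<forall>i\<in>I. g i x = g i y) \<and> g j y < g j x}"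
  \<comment> \<open>For a pair in \<open>P\<close>, the increment of \<open>f - r * g j\<close> has
    modulus at most \<open>e\<close> exactly if \<open>r\<close> lies between \<open>lo\<close> and
    \<open>hi\<close>.\<close>
  define lo hi where "lo = (\<lambda>(x, y). (f x - f y - e) / (g j x - g j y))"
    and "hi = (\<lambda>(x, y). (f x - f y + e) / (g j x - g j y))"
  text \<open>Mixing the pairs \<open>p\<close> and \<open>q\<close>, one of them swapped, with weights that cancel the increments
    of \<open>g j\<close> yields a pair of points on which all of \<open>g\<close> agrees.\<close>
  have cross: "lo p \<le> hi q" if "p \<in> P" "q \<in> P" for p q
  proof -
    obtain x y z w where eq: "p = (x, y)" "q = (z, w)" by (cases p, cases q)
    define d d' t where "d = g j x - g j y" and "d' = g j z - g j w" and "t = d / (d + d')"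
    have S: "x \<in> S" "y \<in> S" "z \<in> S" "w \<in> S" and d: "0 < d" "0 < d'"
      and gI: "\<And>i. i \<in> I \<Longrightarrow> g i x = g i y" "\<And>i. i \<in> I \<Longrightarrow> g i z = g i w"
      using that by (auto simp: P_def eq d_def d'_def)
    have t: "t \<in> {0..1}" "1 - t = d' / (d + d')" using d by (auto simp: t_def field_simps)
    let ?x = "(1 - t) *\<^sub>R x + t *\<^sub>R w" and ?y = "(1 - t) *\<^sub>R y + t *\<^sub>R z"
    have aff: "h ?x = (1 - t) * h x + t * h w" "h ?y = (1 - t) * h y + t * h z"
      if "affine_on S h" for h
      using that S t(1) unfolding affine_on_def by blast+
    have "(1 - t) * d = t * d'" unfolding t(2) by (simp add: t_def)
    then have "g j ?x = g j ?y"
      unfolding aff[OF insert.prems(2)[of j, simplified]] d_def d'_def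
      by (simp only: right_diff_distrib)
    moreover have "g i ?x = g i ?y" if "i \<in> I" for i
      using insert.prems(2)[of i] that gI[OF that] by (simp add: aff)
    moreover have "?x \<in> S" "?y \<in> S" using \<open>convex S\<close> S t(1) by (auto intro: convexD)
    ultimately have "\<bar>f ?x - f ?y\<bar> \<le> e" by (intro insert.prems(3)) auto
    then have "(1 - t) * (f x - f y) - t * (f z - f w) \<le> e"
      unfolding aff[OF insert.prems(1)] by (simp only: right_diff_distrib)
    then have "((1 - t) * (f x - f y) - t * (f z - f w)) * (d + d') \<le> e * (d + d')"
      by (rule mult_right_mono) (use d in simp)
    moreover have "(1 - t) * (d + d') = d'" "t * (d + d') = d"
      unfolding t(2) using d by (simp_all add: t_def)
    ultimately have "d' * (f x - f y) - d * (f z - f w) \<le> e * (d + d')"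
      by (metis left_diff_distrib mult.assoc mult.commute)
    then show ?thesis
      using d unfolding eq lo_def hi_def prod.case d_def[symmetric] d'_def[symmetric]
      by (simp add: divide_le_eq le_divide_eq) (simp add: algebra_simps)
  qed
  \<comment> \<open>By \<open>cross\<close> every lower bound lies below every upper bound, so the
    supremum of the lower bounds serves all pairs; if there are no pairs, any \<open>r\<close> will
    do.\<close>
  obtain r where r: "\<And>p. p \<in> P \<Longrightarrow> lo p \<le> r \<and> r \<le> hi p"
  proof (cases "P = {}")
    case False
    show ?thesis
    proof (rule that[of "Sup (lo ` P)"])
      fix p assume "p \<in> P"
      then show "lo p \<le> Sup (lo ` P) \<and> Sup (lo ` P) \<le> hi p"
        using cross False
        by (intro conjI cSUP_upper cSUP_least bdd_aboveI2[of _ _ "hi p"]) blast+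
    qed
  qed (use that in auto)
  have pair: "\<bar>(f x - r * g j x) - (f y - r * g j y)\<bar> \<le> e" if "(x, y) \<in> P" for x y
  proof -
    have "0 < g j x - g j y" using that by (simp add: P_def)
    with r[OF that] show ?thesis
      by (simp add: lo_def hi_def divide_le_eq le_divide_eq abs_le_iff algebra_simps)
  qed
  \<comment> \<open>Subtracting \<open>r * g j\<close> eliminates the index \<open>j\<close>: two
    points on which the remaining \<open>g i\<close> agree either agree under \<open>g j\<close> too
    or form, in some order, a pair in \<open>P\<close>.\<close>
  have "\<exists>c k. \<forall>x\<in>S. \<bar>(f x - r * g j x) - (k + (\<Sum>i\<in>I. c i * g i x))\<bar> \<le> e"
  proof (rule insert.IH)
    show "affine_on S (\<lambda>x. f x - r * g j x)"
      using insert.prems(1) insert.prems(2)[of j] by (simp add: affine_on_diff_mult)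
    show "affine_on S (g i)" if "i \<in> I" for i using insert.prems(2) that by simp
    fix x y assume xy: "x \<in> S" "y \<in> S" "\<And>i. i \<in> I \<Longrightarrow> g i x = g i y"
    consider "g j x = g j y" | "(x, y) \<in> P" | "(y, x) \<in> P"
      using xy unfolding P_def by fastforce
    then show "\<bar>(f x - r * g j x) - (f y - r * g j y)\<bar> \<le> e"
    proof cases
      case 1
      then show ?thesis using insert.prems(3)[of x y] xy by auto
    next
      case 3
      then show ?thesis using pair[OF 3] by (simp add: abs_minus_commute)
    qed (rule pair)
  qed
  then obtain c k where ck: "\<forall>x\<in>S. \<bar>(f x - r * g j x) - (k + (\<Sum>i\<in>I. c i * g i x))\<bar> \<le> e"
    by blast
  have "(\<Sum>i\<in>insert j I. (c(j := r)) i * g i x) = r * g j x + (\<Sum>i\<in>I. c i * g i x)" for x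
  proof -
    have "(\<Sum>i\<in>I. (c(j := r)) i * g i x) = (\<Sum>i\<in>I. c i * g i x)"
      using insert.hyps by (intro sum.cong) auto
    then show ?thesis using insert.hyps by simp
  qed
  with ck show ?case
    by (intro exI[of _ "c(j := r)"] exI[of _ k]) (simp add: algebra_simps del: fun_upd_apply)
qed

section \<open>Function types and operators\<close>

text \<open>Finitely many basic open boxes, on each of which \<open>f\<close> stays within
  \<open>e / 2\<close> of its value at a centre, cover \<open>S\<close>. Each box restricts finitely
  many coordinates, and a point that agrees with \<open>y\<close> on all of these shares a box with
  \<open>y\<close>.\<close>

lemma continuous_on_compact_finite_coordinates:
  fixes f :: "('i \<Rightarrow> 'b::topological_space) \<Rightarrow> real"
  assumes "compact S" "continuous_on S f" "0 < e"
  shows "\<exists>F. finite F \<and> (\<forall>x\<in>S. \<forall>y\<in>S. (\<forall>i\<in>F. x i = y i) \<longrightarrow> \<bar>f x - f y\<bar> \<le> e)"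
proof -
  have "\<exists>W. x \<in> Pi\<^sub>E UNIV W \<and> (\<forall>i. open (W i)) \<and> finite {i. W i \<noteq> UNIV} \<and>
      (\<forall>y\<in>S \<inter> Pi\<^sub>E UNIV W. \<bar>f y - f x\<bar> < e / 2)" if "x \<in> S" for x
  proof -
    have "open (ball (f x) (e / 2))" "f x \<in> ball (f x) (e / 2)" using \<open>0 < e\<close> by auto
    with assms(2) that obtain U where U: "open U" "x \<in> U" "\<And>y. y \<in> S \<Longrightarrow> y \<in> U \<Longrightarrow> f y \<in> ball (f x) (e / 2)"
      unfolding continuous_on_topological by metis
    have "openin (product_topology (\<lambda>_. euclidean) UNIV) U"
      using U by (simp add: euclidean_product_topology)
    from product_topology_open_contains_basis[OF this U(2)] obtain W where W:
      "x \<in> Pi\<^sub>E UNIV W" "\<And>i. open (W i)" "finite {i. W i \<noteq> UNIV}" "Pi\<^sub>E UNIV W \<subseteq> U"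
      by auto
    have "\<bar>f y - f x\<bar> < e / 2" if "y \<in> S \<inter> Pi\<^sub>E UNIV W" for y
      using U(3)[of y] that W(4) by (auto simp: dist_real_def abs_minus_commute)
    with W show ?thesis by blast
  qed
  then obtain W where W: "\<And>x. x \<in> S \<Longrightarrow> x \<in> Pi\<^sub>E UNIV (W x)" "\<And>x i. x \<in> S \<Longrightarrow> open (W x i)"
    "\<And>x. x \<in> S \<Longrightarrow> finite {i. W x i \<noteq> UNIV}"
    "\<And>x y. x \<in> S \<Longrightarrow> y \<in> S \<Longrightarrow> y \<in> Pi\<^sub>E UNIV (W x) \<Longrightarrow> \<bar>f y - f x\<bar> < e / 2"
    by (metis IntI)
  have "open (Pi\<^sub>E UNIV (W x))" if "x \<in> S" for x
    using W(2,3)[OF that] by (intro open_PiE)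
  then obtain C where C: "C \<subseteq> S" "finite C" "S \<subseteq> (\<Union>x\<in>C. Pi\<^sub>E UNIV (W x))"
  proof (rule compactE_image[OF assms(1), of S "\<lambda>x. Pi\<^sub>E UNIV (W x)"])
    show "S \<subseteq> (\<Union>x\<in>S. Pi\<^sub>E UNIV (W x))" using W(1) by blast
  qed auto
  show ?thesis
  proof (intro exI[of _ "\<Union>x\<in>C. {i. W x i \<noteq> UNIV}"] conjI ballI impI)
    show "finite (\<Union>x\<in>C. {i. W x i \<noteq> UNIV})" using C W(3) by auto
    fix y z assume yz: "y \<in> S" "z \<in> S" "\<forall>i\<in>\<Union>x\<in>C. {i. W x i \<noteq> UNIV}. y i = z i"
    then obtain x where x: "x \<in> C" "y \<in> Pi\<^sub>E UNIV (W x)" using C by blast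
    have "z i \<in> W x i" for i
    proof (cases "W x i = UNIV")
      case False
      then have "y i = z i" using yz(3) x(1) by blast
      then show ?thesis using x(2) by (metis PiE_mem UNIV_I)
    qed simp
    then have "z \<in> Pi\<^sub>E UNIV (W x)" by (simp add: PiE_UNIV_domain)
    moreover have "x \<in> S" using x C(1) by blast
    ultimately have "\<bar>f y - f x\<bar> < e / 2" "\<bar>f z - f x\<bar> < e / 2"
      using W(4) x yz by simp_all
    then show "\<bar>f y - f z\<bar> \<le> e" by linarith
  qed
qed

text \<open>Tychonoff's theorem, transferred to the topology of the function type.\<close>

lemma compact_PiE_UNIV:
  fixes K :: "'i \<Rightarrow> 'b::topological_space set"
  assumes "\<And>i. compact (K i)"
  shows "compact (Pi\<^sub>E UNIV K)"
  using assms compactin_PiE[of "\<lambda>_. euclidean" UNIV K] by (simp add: euclidean_product_topology)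

section \<open>Linear maps on a subspace and conjugation of operators\<close>

lemma linear_map_onD:
  assumes "linear_map_on W T"
  shows linear_map_on_add: "a \<in> W \<Longrightarrow> b \<in> W \<Longrightarrow> T (a + b) = T a + T b"
    and linear_map_on_scaleR: "a \<in> W \<Longrightarrow> T (r *\<^sub>R a) = r *\<^sub>R T a"
  using assms by (auto simp: linear_map_on_def)

lemma linear_map_on_diff:
  assumes "linear_map_on W T" "subspace W" "a \<in> W" "b \<in> W"
  shows "T (a - b) = T a - T b"
proof -
  have "T (a + (- 1) *\<^sub>R b) = T a + (- 1) *\<^sub>R T b"
    using assms by (simp only: linear_map_on_add linear_map_on_scaleR subspace_scale)
  then show ?thesis by simp
qed

lemma linear_map_on_funpow:
  assumes "linear_map_on W T" "T ` W \<subseteq> W"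
  shows "(T ^^ n) ` W \<subseteq> W" "linear_map_on W (T ^^ n)"
proof -
  show *: "(T ^^ n) ` W \<subseteq> W" for n by (induction n) (use assms(2) in auto)
  show "linear_map_on W (T ^^ n)"
  proof (induction n)
    case (Suc n)
    then show ?case
      using assms(1) *[of n] unfolding linear_map_on_def by (simp add: image_subset_iff)
  qed (simp add: linear_map_on_def)
qed

text \<open>The constants \<open>B\<close> and \<open>l\<close> of \<open>T\<close> serve the
  conjugate as well: writing \<open>f\<close> as \<open>P (Q f)\<close> puts the conjugate plus or
  minus \<open>l\<close> into the form of \<open>P\<close> applied to a nonnegative element.\<close>

lemma center_operators_transfer:
  fixes P :: "'w::{real_vector, ord} \<Rightarrow> 'v::{real_vector, ord}"
  assumes T: "T \<in> center_operators N W" and W: "subspace W"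
    and P: "linear_map_on W P" "P ` W \<subseteq> V" "\<And>a. a \<in> W \<Longrightarrow> 0 \<le> a \<Longrightarrow> 0 \<le> P a"
      "\<And>a. a \<in> W \<Longrightarrow> M (P a) = N a"
    and Q: "linear_map_on V Q" "Q ` V \<subseteq> W" "\<And>f. f \<in> V \<Longrightarrow> 0 \<le> f \<Longrightarrow> 0 \<le> Q f"
    and inv: "\<And>f. f \<in> V \<Longrightarrow> P (Q f) = f"
  shows "(\<lambda>f. P (T (Q f))) \<in> center_operators M V"
proof -
  have TW: "T a \<in> W" if "a \<in> W" for a using T that by (auto simp: center_operators_def)
  have QV: "Q f \<in> W" if "f \<in> V" for f using Q(2) that by auto
  have lin: "linear_map_on W T" using T by (simp add: center_operators_def)
  obtain B where B: "\<And>a. a \<in> W \<Longrightarrow> N (T a) \<le> B * N a"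
    using T by (auto simp: center_operators_def)
  obtain l :: real where l: "0 \<le> l" "\<And>a. a \<in> W \<Longrightarrow> 0 \<le> a \<Longrightarrow> 0 \<le> T a + l *\<^sub>R a"
    "\<And>a. a \<in> W \<Longrightarrow> 0 \<le> a \<Longrightarrow> 0 \<le> l *\<^sub>R a - T a"
    using T by (auto simp: center_operators_def nonneg_operator_def)
  have "M (P (T (Q f))) \<le> B * M f" if "f \<in> V" for f
    using B[OF QV[OF that]] P(4) TW QV inv that by metis
  then have "\<exists>B. \<forall>f\<in>V. M (P (T (Q f))) \<le> B * M f" by blast
  moreover have "linear_map_on V (\<lambda>f. P (T (Q f)))"
    unfolding linear_map_on_def
    by (simp add: linear_map_onD[OF P(1)] linear_map_onD[OF lin] linear_map_onD[OF Q(1)] TW QV)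
  moreover have "P (T (Q f)) + l *\<^sub>R f = P (T (Q f) + l *\<^sub>R Q f)"
    "l *\<^sub>R f - P (T (Q f)) = P (l *\<^sub>R Q f - T (Q f))" if "f \<in> V" for f
    using that W by (simp_all add: linear_map_onD[OF P(1)] linear_map_on_diff[OF P(1)]
      TW QV inv subspace_scale)
  moreover have "0 \<le> P (T (Q f) + l *\<^sub>R Q f)" "0 \<le> P (l *\<^sub>R Q f - T (Q f))"
    if "f \<in> V" "0 \<le> f" for f
    using that W by (auto intro!: P(3) l(2,3) Q(3) subspace_add subspace_diff subspace_scale TW QV)
  ultimately show ?thesis
    using P(2) TW QV l(1) unfolding center_operators_def nonneg_operator_def
    by (auto intro!: exI[of _ l])
qed

lemma center_operatorsD:
  assumes "T \<in> center_operators N W"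
  shows "a \<in> W \<Longrightarrow> T a \<in> W" and "linear_map_on W T"
    and "\<exists>l\<ge>0. \<forall>a\<in>W. 0 \<le> a \<longrightarrow> 0 \<le> T a + l *\<^sub>R a \<and> 0 \<le> l *\<^sub>R a - T a"
  using assms by (auto simp: center_operators_def nonneg_operator_def)

lemma scaleR_fun_apply [simp]: "(r *\<^sub>R f) x = r *\<^sub>R f x"
  by (simp add: scaleR_fun_def)

lemma center_memI: "T \<in> center_operators (sup_norm X) H \<Longrightarrow> T (indicator X) \<in> center X H"
  by (auto simp: center_def)

section \<open>States of an intermediate function space\<close>

text \<open>Over the empty set \<open>sup_norm\<close> would be the unspecified
  \<open>Sup {}\<close> and there would be no states; that case is handled apart.\<close>

locale nonempty_intermediate_space =
  fixes X :: "'a::locally_convex_tvs set" and H :: "('a \<Rightarrow> real) set"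
  assumes compact_convex: "compact_convex X"
    and intermediate: "intermediate_function_space X H"
    and nonempty: "X \<noteq> {}"
begin

abbreviation S :: "(('a \<Rightarrow> real) \<Rightarrow> real) set" where "S \<equiv> state_space X H"

lemma subspace_H: "subspace H"
  using intermediate by (simp add: intermediate_function_space_def)

lemma H_combine [simp]:
  shows "a \<in> H \<Longrightarrow> b \<in> H \<Longrightarrow> a + b \<in> H" and "a \<in> H \<Longrightarrow> b \<in> H \<Longrightarrow> a - b \<in> H"
    and "a \<in> H \<Longrightarrow> r *\<^sub>R a \<in> H"
  using subspace_H by (auto intro: subspace_add subspace_diff subspace_scale)

lemma H_outside: "a \<in> H \<Longrightarrow> x \<notin> X \<Longrightarrow> a x = 0"
  using intermediate by (auto simp: intermediate_function_space_def A_b_def affine_functions_def)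

lemma H_affine:
  assumes "a \<in> H" "x \<in> X" "y \<in> X" "t \<in> {0..1}"
  shows "a ((1 - t) *\<^sub>R x + t *\<^sub>R y) = (1 - t) * a x + t * a y"
proof -
  have "a \<in> affine_functions X"
    using assms(1) intermediate by (auto simp: intermediate_function_space_def A_b_def)
  with assms show ?thesis by (simp add: affine_functions_def)
qed

lemma convex_X: "convex X" and compact_X: "compact X"
  using compact_convex by (auto simp: compact_convex_def)

lemma convex_X_combine: "x \<in> X \<Longrightarrow> y \<in> X \<Longrightarrow> t \<in> {0..1} \<Longrightarrow> (1 - t) *\<^sub>R x + t *\<^sub>R y \<in> X"
  using convex_X by (auto intro: convexD)

lemma one_H [simp]: "indicator X \<in> H"
proof -
  have "indicator X \<in> affine_functions X"
    by (simp add: affine_functions_def convex_X_combine)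
  moreover have "continuous_on X (indicator X :: 'a \<Rightarrow> real)"
    by (rule continuous_on_eq[OF continuous_on_const[of _ 1]]) simp
  ultimately have "indicator X \<in> A_c X" by (simp add: A_c_def)
  then show ?thesis using intermediate by (auto simp: intermediate_function_space_def)
qed

lemma abs_le_sup_norm:
  assumes "a \<in> H"
  shows "\<bar>a x\<bar> \<le> sup_norm X a"
proof -
  have "bounded (a ` X)"
    using assms intermediate by (auto simp: intermediate_function_space_def A_b_def)
  then obtain M where "\<And>x. x \<in> X \<Longrightarrow> \<bar>a x\<bar> \<le> M" by (auto simp: bounded_iff)
  then have bdd: "bdd_above ((\<lambda>x. \<bar>a x\<bar>) ` X)" by (rule bdd_aboveI2)
  have *: "\<bar>a x\<bar> \<le> sup_norm X a" if "x \<in> X" for x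
    unfolding sup_norm_def using cSUP_upper[OF that bdd] .
  show ?thesis
  proof (cases "x \<in> X")
    case False
    obtain y where "y \<in> X" using nonempty by blast
    with * have "0 \<le> sup_norm X a" by force
    then show ?thesis using H_outside[OF assms False] by simp
  qed (rule *)
qed

lemma sup_norm_le: "(\<And>x. x \<in> X \<Longrightarrow> \<bar>a x\<bar> \<le> c) \<Longrightarrow> sup_norm X a \<le> c"
  unfolding sup_norm_def by (rule cSUP_least[OF nonempty])

lemma sup_norm_nonneg: "a \<in> H \<Longrightarrow> 0 \<le> sup_norm X a"
  using abs_le_sup_norm[of a] by (meson abs_ge_zero order_trans)

lemma zero_H [simp]: "0 \<in> H"
  using subspace_H by (rule subspace_0)

lemma sup_norm_scaleR:
  assumes "a \<in> H"
  shows "sup_norm X (r *\<^sub>R a) \<le> \<bar>r\<bar> * sup_norm X a"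
  by (rule sup_norm_le) (simp add: abs_mult mult_left_mono abs_le_sup_norm assms)

text \<open>Scaling into the unit ball turns the condition on \<open>dual_norm\<close> into a bound
  at each \<open>a\<close>. The bound \<open>B\<close> from \<open>dual_space\<close> ensures that
  the supremum in \<open>dual_norm\<close> is over a bounded set, and it settles the case of norm
  \<open>0\<close>.\<close>

lemma state_space_iff:
  "\<phi> \<in> S \<longleftrightarrow> linear_map_on H \<phi> \<and> (\<forall>a\<in>H. \<bar>\<phi> a\<bar> \<le> sup_norm X a) \<and> (\<forall>a. a \<notin> H \<longrightarrow> \<phi> a = 0) \<and>
     \<phi> (indicator X) = 1"
proof
  assume S: "\<phi> \<in> S"
  then have lin: "linear_map_on H \<phi>" and one: "\<phi> (indicator X) = 1" and out: "\<forall>a. a \<notin> H \<longrightarrow> \<phi> a = 0"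
    and norm: "Sup {\<bar>\<phi> a\<bar> | a. a \<in> H \<and> sup_norm X a \<le> 1} \<le> 1"
    by (auto simp: state_space_def dual_space_def dual_norm_def)
  obtain B where B: "\<And>a. a \<in> H \<Longrightarrow> \<bar>\<phi> a\<bar> \<le> B * sup_norm X a"
    using S by (auto simp: state_space_def dual_space_def)
  have "\<bar>\<phi> a\<bar> \<le> \<bar>B\<bar>" if a: "a \<in> H" "sup_norm X a \<le> 1" for a
  proof -
    have "\<bar>\<phi> a\<bar> \<le> \<bar>B\<bar> * sup_norm X a"
      using B[OF a(1)] sup_norm_nonneg[OF a(1)]
      by (meson abs_ge_self mult_right_mono order_trans)
    also have "\<dots> \<le> \<bar>B\<bar> * 1" using a(2) by (intro mult_left_mono) auto
    finally show ?thesis by simp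
  qed
  then have "bdd_above {\<bar>\<phi> a\<bar> | a. a \<in> H \<and> sup_norm X a \<le> 1}"
    by (auto intro!: bdd_aboveI[of _ "\<bar>B\<bar>"])
  then have unit: "\<bar>\<phi> a\<bar> \<le> 1" if "a \<in> H" "sup_norm X a \<le> 1" for a
    using that by (intro order_trans[OF cSup_upper norm]) auto
  have "\<bar>\<phi> a\<bar> \<le> sup_norm X a" if a: "a \<in> H" for a
  proof (cases "sup_norm X a = 0")
    case True
    then show ?thesis using B[OF a] by simp
  next
    case False
    define s where "s = sup_norm X a"
    have "0 < s" using False sup_norm_nonneg[OF a] by (simp add: s_def)
    then have "sup_norm X (inverse s *\<^sub>R a) \<le> 1"
      using sup_norm_scaleR[OF a, of "inverse s"] by (simp add: s_def[symmetric])
    then have "\<bar>\<phi> (inverse s *\<^sub>R a)\<bar> \<le> 1" using a by (intro unit) auto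
    then show ?thesis
      using \<open>0 < s\<close> a
      by (simp add: linear_map_on_scaleR[OF lin] abs_mult s_def[symmetric] field_simps)
  qed
  with lin one out show "linear_map_on H \<phi> \<and> (\<forall>a\<in>H. \<bar>\<phi> a\<bar> \<le> sup_norm X a) \<and>
      (\<forall>a. a \<notin> H \<longrightarrow> \<phi> a = 0) \<and> \<phi> (indicator X) = 1" by blast
next
  assume *: "linear_map_on H \<phi> \<and> (\<forall>a\<in>H. \<bar>\<phi> a\<bar> \<le> sup_norm X a) \<and> (\<forall>a. a \<notin> H \<longrightarrow> \<phi> a = 0) \<and>
     \<phi> (indicator X) = 1"
  have "sup_norm X 0 \<le> 1" by (rule sup_norm_le) simp
  then have "dual_norm X H \<phi> \<le> 1"
    unfolding dual_norm_def using * zero_H by (intro cSup_least) (auto intro: order_trans exI[of _ 0])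
  moreover have "\<exists>B. \<forall>a\<in>H. \<bar>\<phi> a\<bar> \<le> B * sup_norm X a" using * by (intro exI[of _ 1]) simp
  ultimately show "\<phi> \<in> S" using * by (simp add: state_space_def dual_space_def)
qed

lemma state_simps:
  assumes "\<phi> \<in> S"
  shows state_add: "a \<in> H \<Longrightarrow> b \<in> H \<Longrightarrow> \<phi> (a + b) = \<phi> a + \<phi> b"
    and state_scaleR: "a \<in> H \<Longrightarrow> \<phi> (r *\<^sub>R a) = r * \<phi> a"
    and state_diff: "a \<in> H \<Longrightarrow> b \<in> H \<Longrightarrow> \<phi> (a - b) = \<phi> a - \<phi> b"
    and state_one: "\<phi> (indicator X) = 1"
  using assms linear_map_on_diff[OF _ subspace_H, of \<phi>]
  by (auto simp: state_space_iff linear_map_on_def)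

lemma state_abs_le: "\<phi> \<in> S \<Longrightarrow> a \<in> H \<Longrightarrow> \<bar>\<phi> a\<bar> \<le> sup_norm X a"
  by (simp add: state_space_iff)

text \<open>If \<open>0 \<le> a\<close> and \<open>s\<close> is the norm of \<open>a\<close>, then
  \<open>s - a\<close> has norm at most \<open>s\<close> too, so
  \<open>s - \<phi> a \<le> s\<close>.\<close>

lemma state_nonneg:
  assumes "\<phi> \<in> S" "a \<in> H" "0 \<le> a"
  shows "0 \<le> \<phi> a"
proof -
  let ?s = "sup_norm X a"
  have "0 \<le> a x" "a x \<le> ?s" for x
    using assms(3) abs_le_sup_norm[OF assms(2), of x] by (auto simp: le_fun_def)
  then have "sup_norm X (?s *\<^sub>R indicator X - a) \<le> ?s"
    by (intro sup_norm_le) (simp add: abs_le_iff)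
  then have "\<phi> (?s *\<^sub>R indicator X - a) \<le> ?s"
    using state_abs_le[OF assms(1), of "?s *\<^sub>R indicator X - a"] assms(2) by simp
  then show ?thesis
    using assms(1,2) by (simp add: state_simps)
qed

lemma evaluation_apply [simp]: "a \<in> H \<Longrightarrow> evaluation H x a = a x"
  by (simp add: evaluation_def)

lemma evaluation_state:
  assumes "x \<in> X"
  shows "evaluation H x \<in> S"
  using assms abs_le_sup_norm[of _ x] unfolding state_space_iff linear_map_on_def
  by (simp add: evaluation_def)

lemma S_nonempty: "S \<noteq> {}"
  using evaluation_state nonempty by blast

lemma convex_S: "convex S"
proof (rule convexI)
  fix \<phi> \<psi> and s t :: real
  assume *: "\<phi> \<in> S" "\<psi> \<in> S" "0 \<le> s" "0 \<le> t" "s + t = 1"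
  have "\<bar>s * \<phi> a + t * \<psi> a\<bar> \<le> sup_norm X a" if "a \<in> H" for a
  proof -
    have "\<bar>s * \<phi> a + t * \<psi> a\<bar> \<le> s * \<bar>\<phi> a\<bar> + t * \<bar>\<psi> a\<bar>"
      using *(3,4) abs_triangle_ineq[of "s * \<phi> a" "t * \<psi> a"] by (simp add: abs_mult)
    also have "\<dots> \<le> s * sup_norm X a + t * sup_norm X a"
      using * that by (intro add_mono mult_left_mono state_abs_le)
    finally show ?thesis using *(5) by (simp flip: distrib_right)
  qed
  moreover have "linear_map_on H (s *\<^sub>R \<phi> + t *\<^sub>R \<psi>)"
    using *(1,2) unfolding linear_map_on_def
    by (simp add: state_add state_scaleR algebra_simps)
  ultimately show "s *\<^sub>R \<phi> + t *\<^sub>R \<psi> \<in> S"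
    using * by (auto simp: state_space_iff)
qed

text \<open>Banach-Alaoglu: the norm bounds place \<open>S\<close> in a product of compact
  intervals, and linearity and normalization are closed conditions. Off \<open>H\<close> the factor
  is \<open>{0}\<close> because functionals are extended by zero.\<close>

lemma compact_S: "compact S"
proof -
  define K where "K a = (if a \<in> H then {- sup_norm X a..sup_norm X a} else {0})" for a
  define L where "L = (\<Inter>a\<in>H. \<Inter>b\<in>H. {\<phi>. \<phi> (a + b) = \<phi> a + \<phi> b}) \<inter>
    (\<Inter>a\<in>H. \<Inter>r. {\<phi>. \<phi> (r *\<^sub>R a) = r *\<^sub>R \<phi> a}) \<inter> {\<phi>::('a \<Rightarrow> real) \<Rightarrow> real. \<phi> (indicator X) = 1}"
  have "S = Pi\<^sub>E UNIV K \<inter> L"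
    unfolding K_def L_def PiE_UNIV_domain set_eq_iff
    by (auto simp: state_space_iff linear_map_on_def Pi_iff abs_le_iff minus_le_iff split: if_splits)
  moreover have "closed L"
    unfolding L_def
    by (intro closed_Int closed_INT ballI closed_Collect_eq continuous_intros
        continuous_on_product_coordinates)
  moreover have "compact (Pi\<^sub>E UNIV K)"
    by (rule compact_PiE_UNIV) (simp add: K_def)
  ultimately show ?thesis by (simp add: compact_Int_closed)
qed

section \<open>Representation by affine functions on the state space\<close>

definition to_states :: "('a \<Rightarrow> real) \<Rightarrow> (('a \<Rightarrow> real) \<Rightarrow> real) \<Rightarrow> real" where
  "to_states a \<phi> = (if \<phi> \<in> S then \<phi> a else 0)"

text \<open>Composition with the evaluation map; it turns out to invert
  \<open>to_states\<close>.\<close>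

definition from_states :: "((('a \<Rightarrow> real) \<Rightarrow> real) \<Rightarrow> real) \<Rightarrow> 'a \<Rightarrow> real" where
  "from_states f x = (if x \<in> X then f (evaluation H x) else 0)"

lemma to_states_A_c: "a \<in> H \<Longrightarrow> to_states a \<in> A_c S"
proof -
  have "continuous_on S (\<lambda>\<phi>. \<phi> a)"
    by (rule continuous_on_subset[OF continuous_on_product_coordinates]) simp
  then have "continuous_on S (to_states a)"
    by (rule continuous_on_eq) (simp add: to_states_def)
  moreover have "(1 - t) *\<^sub>R \<phi> + t *\<^sub>R \<psi> \<in> S" if "\<phi> \<in> S" "\<psi> \<in> S" "t \<in> {0..1}" for \<phi> \<psi> t
    using that convex_S by (auto intro: convexD)
  ultimately show ?thesis by (simp add: A_c_def affine_functions_def to_states_def)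
qed

lemma from_to_states: "a \<in> H \<Longrightarrow> from_states (to_states a) = a"
  by (auto simp: from_states_def to_states_def evaluation_state H_outside)

lemma to_states_one: "to_states (indicator X) = indicator S"
  by (auto simp: to_states_def state_one indicator_def)

text \<open>States have norm at most 1, and the evaluations at points of \<open>X\<close>, which are
  states, already attain the values of \<open>a\<close>.\<close>

lemma sup_norm_to_states:
  assumes "a \<in> H"
  shows "sup_norm S (to_states a) = sup_norm X a"
proof (rule antisym)
  have le: "\<bar>to_states a \<phi>\<bar> \<le> sup_norm X a" if "\<phi> \<in> S" for \<phi>
    using that assms by (simp add: to_states_def state_abs_le)
  then show "sup_norm S (to_states a) \<le> sup_norm X a"
    unfolding sup_norm_def[of S] by (intro cSUP_least S_nonempty)
  have bdd: "bdd_above ((\<lambda>\<phi>. \<bar>to_states a \<phi>\<bar>) ` S)" using le by (rule bdd_aboveI2)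
  show "sup_norm X a \<le> sup_norm S (to_states a)"
  proof (rule sup_norm_le)
    fix x assume "x \<in> X"
    then show "\<bar>a x\<bar> \<le> sup_norm S (to_states a)"
      unfolding sup_norm_def[of S]
      using cSUP_upper[OF evaluation_state bdd, of x] assms
      by (simp add: to_states_def evaluation_state)
  qed
qed

lemma evaluation_affine:
  assumes "x \<in> X" "y \<in> X" "t \<in> {0..1}"
  shows "evaluation H ((1 - t) *\<^sub>R x + t *\<^sub>R y) = (1 - t) *\<^sub>R evaluation H x + t *\<^sub>R evaluation H y"
  by (rule HOL.ext) (simp add: evaluation_def H_affine[OF _ assms])

text \<open>Boundedness comes from compactness of \<open>S\<close>, affinity from that of
  evaluation. Continuity may be lost, since evaluation is discontinuous if \<open>H\<close> contains
  a function discontinuous on \<open>X\<close>.\<close>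

lemma from_states_A_b:
  assumes "f \<in> A_c S"
  shows "from_states f \<in> A_b X"
proof -
  have f: "continuous_on S f" "f \<in> affine_functions S" using assms by (auto simp: A_c_def)
  have "bounded (f ` S)"
    by (intro compact_imp_bounded compact_continuous_image compact_S f)
  then have "bounded (from_states f ` X)"
    by (rule bounded_subset) (auto simp: from_states_def evaluation_state)
  moreover have "from_states f \<in> affine_functions X"
    using f(2) by (simp add: affine_functions_def from_states_def evaluation_affine
        evaluation_state convex_X_combine)
  ultimately show ?thesis by (simp add: A_b_def)
qed

lemma A_c_approximation:
  assumes "f \<in> A_c S" "0 < e"
  obtains a where "a \<in> H" "\<And>\<phi>. \<phi> \<in> S \<Longrightarrow> \<bar>f \<phi> - \<phi> a\<bar> \<le> e"
proof -
  have f: "continuous_on S f" "affine_on S f"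
    using assms by (auto simp: A_c_def affine_on_def affine_functions_def)
  obtain F where F: "finite F"
    "\<And>\<phi> \<psi>. \<phi> \<in> S \<Longrightarrow> \<psi> \<in> S \<Longrightarrow> \<forall>a\<in>F. \<phi> a = \<psi> a \<Longrightarrow> \<bar>f \<phi> - f \<psi>\<bar> \<le> e"
    using continuous_on_compact_finite_coordinates[OF compact_S f(1) assms(2)] by blast
  \<comment> \<open>Coordinates outside \<open>H\<close> vanish on \<open>S\<close>, so those in
    \<open>F \<inter> H\<close> suffice.\<close>
  have "\<exists>c k. \<forall>\<phi>\<in>S. \<bar>f \<phi> - (k + (\<Sum>a\<in>F \<inter> H. c a * \<phi> a))\<bar> \<le> e"
  proof (rule affine_approximation[OF _ convex_S S_nonempty f(2)])
    show "affine_on S (\<lambda>\<phi>. \<phi> a)" for a by (simp add: affine_on_def)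
    fix \<phi> \<psi> assume *: "\<phi> \<in> S" "\<psi> \<in> S" "\<And>a. a \<in> F \<inter> H \<Longrightarrow> \<phi> a = \<psi> a"
    have "\<phi> a = \<psi> a" if "a \<in> F" for a
      using * that by (cases "a \<in> H") (auto simp: state_space_iff)
    then show "\<bar>f \<phi> - f \<psi>\<bar> \<le> e" using *(1,2) by (intro F(2)) auto
  qed (use F(1) in simp)
  then obtain c k where ck: "\<And>\<phi>. \<phi> \<in> S \<Longrightarrow> \<bar>f \<phi> - (k + (\<Sum>a\<in>F \<inter> H. c a * \<phi> a))\<bar> \<le> e"
    by blast
  have "(\<Sum>a\<in>A. c a *\<^sub>R a) \<in> H \<and> (\<forall>\<phi>\<in>S. \<phi> (\<Sum>a\<in>A. c a *\<^sub>R a) = (\<Sum>a\<in>A. c a * \<phi> a))"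
    if "finite A" "A \<subseteq> H" for A
    using that
  proof (induction rule: finite_induct)
    case empty
    then show ?case using state_scaleR[of _ 0 0] by (simp add: zero_fun_def[symmetric])
  qed (auto simp: state_add state_scaleR)
  from this[of "F \<inter> H"] F(1) have sum: "(\<Sum>a\<in>F \<inter> H. c a *\<^sub>R a) \<in> H"
    "\<And>\<phi>. \<phi> \<in> S \<Longrightarrow> \<phi> (\<Sum>a\<in>F \<inter> H. c a *\<^sub>R a) = (\<Sum>a\<in>F \<inter> H. c a * \<phi> a)"
    by auto
  show thesis
    \<comment> \<open>States map \<open>indicator X\<close> to \<open>1\<close>, so the constant
      \<open>k\<close> is the value of a multiple of \<open>indicator X\<close>.\<close>
    by (rule that[of "k *\<^sub>R indicator X + (\<Sum>a\<in>F \<inter> H. c a *\<^sub>R a)"])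
      (use ck in \<open>simp_all add: sum state_add state_scaleR state_one\<close>)
qed

text \<open>The approximants of \<open>f\<close> on \<open>S\<close> approximate
  \<open>from_states f\<close> uniformly on \<open>X\<close>, and \<open>H\<close> is
  closed.\<close>

lemma from_states_H:
  assumes f: "f \<in> A_c S"
  shows "from_states f \<in> H"
proof -
  have "\<exists>v\<in>H. sup_norm X (from_states f - v) < e" if "0 < e" for e
  proof -
    obtain a where a: "a \<in> H" "\<And>\<phi>. \<phi> \<in> S \<Longrightarrow> \<bar>f \<phi> - \<phi> a\<bar> \<le> e / 2"
      using A_c_approximation[OF f, of "e / 2"] \<open>0 < e\<close> by auto
    have "sup_norm X (from_states f - a) \<le> e / 2"
      by (rule sup_norm_le)
        (use a(1) a(2)[OF evaluation_state] in \<open>simp add: from_states_def\<close>)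
    with \<open>0 < e\<close> a(1) show ?thesis by (intro bexI[of _ a]) auto
  qed
  then show ?thesis
    using from_states_A_b[OF f] intermediate by (simp add: intermediate_function_space_def)
qed

text \<open>At evaluations the two sides agree by construction. At any other state both are compared
  with the value of an approximant \<open>a\<close>, using that a state is a contraction.\<close>

lemma to_from_states:
  assumes f: "f \<in> A_c S"
  shows "to_states (from_states f) = f"
proof
  fix \<phi>
  show "to_states (from_states f) \<phi> = f \<phi>"
  proof (cases "\<phi> \<in> S")
    case False
    then show ?thesis using f by (simp add: to_states_def A_c_def affine_functions_def)
  next
    case True
    have "\<bar>\<phi> (from_states f) - f \<phi>\<bar> \<le> e" if "0 < e" for e
    proof -
      obtain a where a: "a \<in> H" "\<And>\<phi>. \<phi> \<in> S \<Longrightarrow> \<bar>f \<phi> - \<phi> a\<bar> \<le> e / 2"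
        using A_c_approximation[OF f, of "e / 2"] \<open>0 < e\<close> by auto
      have "sup_norm X (from_states f - a) \<le> e / 2"
        by (rule sup_norm_le)
          (use a(1) a(2)[OF evaluation_state] in \<open>simp add: from_states_def\<close>)
      then have "\<bar>\<phi> (from_states f) - \<phi> a\<bar> \<le> e / 2"
        using state_abs_le[OF True, of "from_states f - a"] True a(1) from_states_H[OF f]
        by (simp add: state_diff)
      with a(2)[OF True] show ?thesis by linarith
    qed
    then have "\<bar>\<phi> (from_states f) - f \<phi>\<bar> \<le> 0" by (rule field_le_epsilon) simp
    with True show ?thesis by (simp add: to_states_def)
  qed
qed

lemma linear_to_states: "linear_map_on H to_states"
  by (auto simp: linear_map_on_def to_states_def fun_eq_iff state_add state_scaleR)

lemma linear_from_states: "linear_map_on F from_states"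
  by (auto simp: linear_map_on_def from_states_def fun_eq_iff)

lemma to_states_nonneg: "a \<in> H \<Longrightarrow> 0 \<le> a \<Longrightarrow> 0 \<le> to_states a"
  by (simp add: le_fun_def to_states_def) (metis state_nonneg le_fun_def zero_fun_apply)

lemma from_states_nonneg: "0 \<le> f \<Longrightarrow> 0 \<le> from_states f"
  by (simp add: le_fun_def from_states_def)

section \<open>Transfer of central operators between \<open>H\<close> and
  \<open>A_c S\<close>\<close>

lemma center_operators_to_states:
  assumes "T \<in> center_operators (sup_norm X) H"
  shows "(\<lambda>f. to_states (T (from_states f))) \<in> center_operators (sup_norm S) (A_c S)"
  by (rule center_operators_transfer[OF assms subspace_H])
    (auto simp: linear_to_states linear_from_states to_states_A_c to_states_nonneg
      sup_norm_to_states from_states_H from_states_nonneg to_from_states)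

text \<open>By \<open>to_from_states\<close>, \<open>A_c S\<close> is the image of \<open>H\<close>
  under the linear map \<open>to_states\<close>.\<close>

lemma subspace_A_c: "subspace (A_c S)"
proof (rule subspaceI)
  have add: "to_states (a + b) = to_states a + to_states b" if "a \<in> H" "b \<in> H" for a b
    using that linear_to_states by (simp add: linear_map_onD)
  have scale: "to_states (r *\<^sub>R a) = r *\<^sub>R to_states a" if "a \<in> H" for a r
    using that linear_to_states by (simp add: linear_map_onD)
  show "f + g \<in> A_c S" if "f \<in> A_c S" "g \<in> A_c S" for f g
    using that to_states_A_c[of "from_states f + from_states g"]
    by (simp add: add to_from_states from_states_H)
  show "r *\<^sub>R f \<in> A_c S" if "f \<in> A_c S" for f r
    using that to_states_A_c[of "r *\<^sub>R from_states f"]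
    by (simp add: scale to_from_states from_states_H)
  have "to_states 0 = 0" using scale[of 0 0] by simp
  then show "0 \<in> A_c S" using to_states_A_c[of 0] by simp
qed

lemma center_operators_from_states:
  assumes "T \<in> center_operators (sup_norm S) (A_c S)"
  shows "(\<lambda>a. from_states (T (to_states a))) \<in> center_operators (sup_norm X) H"
  by (rule center_operators_transfer[OF assms subspace_A_c])
    (auto simp: linear_to_states linear_from_states to_states_A_c to_states_nonneg
      sup_norm_to_states[symmetric] from_states_H from_states_nonneg to_from_states from_to_states)

text \<open>Apply \<open>P\<close> to the nonnegative functions \<open>c - a\<close> and
  \<open>c + a\<close> on \<open>X\<close>. The factor \<open>indicator X x\<close> records
  vanishing outside \<open>X\<close>, so that the bound can be iterated.\<close>

lemma positive_operator_contraction: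
  assumes "linear_map_on H P" "P ` H \<subseteq> H" "nonneg_operator H P" "P (indicator X) = indicator X"
    and "a \<in> H" "\<And>x. \<bar>a x\<bar> \<le> c * indicator X x"
  shows "\<bar>P a x\<bar> \<le> c * indicator X x"
proof -
  let ?c = "c *\<^sub>R indicator X"
  have "0 \<le> (?c - a) y" "0 \<le> (?c + a) y" for y
    using assms(6)[of y] by (simp_all add: abs_le_iff)
  then have "0 \<le> ?c - a" "0 \<le> ?c + a" by (simp_all only: le_fun_def zero_fun_apply simp_thms)
  then have "0 \<le> P (?c - a)" "0 \<le> P (?c + a)"
    using assms(3,5) by (auto simp: nonneg_operator_def)
  then have "0 \<le> ?c - P a" "0 \<le> ?c + P a"
    using assms(1,4,5)
    by (simp_all add: linear_map_on_diff[OF _ subspace_H] linear_map_onD)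
  then have "0 \<le> (?c - P a) x" "0 \<le> (?c + P a) x" unfolding le_fun_def by simp_all
  then show ?thesis by (simp add: abs_le_iff)
qed

section \<open>Operators in the center\<close>

text \<open>\<open>P\<close> and \<open>Q\<close> are Markov operators with \<open>P + Q = 2 I\<close>, so their iterates applied to \<open>a\<close> form a
  bounded harmonic function on the quadrant.\<close>
lemma center_operators_eqI:
  assumes T: "T \<in> center_operators N H" and U: "U \<in> center_operators N H"
    and one: "T (indicator X) = U (indicator X)" and a: "a \<in> H"
  shows "T a = U a"
proof
  fix x
  obtain l where l: "0 \<le> l" "\<And>b. b \<in> H \<Longrightarrow> 0 \<le> b \<Longrightarrow> 0 \<le> T b + l *\<^sub>R b \<and> 0 \<le> l *\<^sub>R b - T b"
    using center_operatorsD(3)[OF T] by (elim exE conjE) simp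
  obtain m where m: "0 \<le> m" "\<And>b. b \<in> H \<Longrightarrow> 0 \<le> b \<Longrightarrow> 0 \<le> U b + m *\<^sub>R b \<and> 0 \<le> m *\<^sub>R b - U b"
    using center_operatorsD(3)[OF U] by (elim exE conjE) simp
  \<comment> \<open>\<open>T - U\<close> lies between \<open>-(l + m) I\<close> and
    \<open>(l + m) I\<close>; the summand \<open>1\<close> keeps \<open>r\<close> positive if both
    bounds are \<open>0\<close>.\<close>
  define r where "r = l + m + 1"
  have "0 < r" using l(1) m(1) by (simp add: r_def)
  define P Q where "P b = b + (1 / r) *\<^sub>R (T b - U b)" and "Q b = b - (1 / r) *\<^sub>R (T b - U b)" for b
  have in_H: "T b \<in> H" "U b \<in> H" if "b \<in> H" for b
    using that center_operatorsD(1)[OF T] center_operatorsD(1)[OF U] by auto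
  have PQ_H: "P ` H \<subseteq> H" "Q ` H \<subseteq> H" by (auto simp: P_def Q_def in_H)
  have PQ_lin: "linear_map_on H P" "linear_map_on H Q"
    unfolding linear_map_on_def P_def Q_def
    by (simp_all add: linear_map_onD[OF center_operatorsD(2)[OF T]]
        linear_map_onD[OF center_operatorsD(2)[OF U]] algebra_simps)
  have PQ_one: "P (indicator X) = indicator X" "Q (indicator X) = indicator X"
    by (simp_all add: P_def Q_def one)
  have "0 \<le> P b y \<and> 0 \<le> Q b y" if b: "b \<in> H" "0 \<le> b" for b y
  proof -
    have "0 \<le> (T b + l *\<^sub>R b) y" "0 \<le> (l *\<^sub>R b - T b) y" "0 \<le> (U b + m *\<^sub>R b) y"
      "0 \<le> (m *\<^sub>R b - U b) y" "0 \<le> b y"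
      using l(2)[OF b] m(2)[OF b] b(2) by (simp_all only: le_fun_def zero_fun_apply)
    then have "0 \<le> r * b y + (T b y - U b y)" "0 \<le> r * b y - (T b y - U b y)"
      by (simp_all add: r_def distrib_right)
    moreover have "P b y = (r * b y + (T b y - U b y)) / r" "Q b y = (r * b y - (T b y - U b y)) / r"
      using \<open>0 < r\<close> by (simp_all add: P_def Q_def add_divide_distrib diff_divide_distrib)
    ultimately show ?thesis using \<open>0 < r\<close> by simp
  qed
  then have PQ_nonneg: "nonneg_operator H P" "nonneg_operator H Q"
    by (simp_all add: nonneg_operator_def le_fun_def)
  have P_pow: "linear_map_on H (P ^^ i)" for i by (rule linear_map_on_funpow[OF PQ_lin(1) PQ_H(1)])
  have Q_pow_H: "(Q ^^ j) a \<in> H" for j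
    using linear_map_on_funpow(1)[OF PQ_lin(2) PQ_H(2), of j] a by auto
  have P_pow_H: "(P ^^ i) b \<in> H" if "b \<in> H" for i b
    using linear_map_on_funpow(1)[OF PQ_lin(1) PQ_H(1), of i] that by auto
  have Q_bound: "\<bar>(Q ^^ j) a y\<bar> \<le> sup_norm X a * indicator X y" for j y
  proof (induction j arbitrary: y)
    case 0
    then show ?case using abs_le_sup_norm[OF a, of y] H_outside[OF a, of y]
      by (auto simp: indicator_def)
  next
    case (Suc j)
    show ?case
      using positive_operator_contraction[OF PQ_lin(2) PQ_H(2) PQ_nonneg(2) PQ_one(2) Q_pow_H Suc]
      by simp
  qed
  have bound: "\<bar>(P ^^ i) ((Q ^^ j) a) y\<bar> \<le> sup_norm X a * indicator X y" for i j y
  proof (induction i arbitrary: y)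
    case 0
    then show ?case using Q_bound by simp
  next
    case (Suc i)
    show ?case
      using positive_operator_contraction[OF PQ_lin(1) PQ_H(1) PQ_nonneg(1) PQ_one(1)
          P_pow_H[OF Q_pow_H] Suc]
      by simp
  qed
  define v where "v i j = (P ^^ i) ((Q ^^ j) a) x" for i j
  have "v i j = (v (Suc i) j + v i (Suc j)) / 2" for i j
  proof -
    let ?b = "(Q ^^ j) a"
    have H: "P ?b \<in> H" "Q ?b \<in> H" using Q_pow_H PQ_H by auto
    \<comment> \<open>Applying the linear map \<open>P ^^ i\<close> to this identity gives
      harmonicity of \<open>v\<close>.\<close>
    have "2 *\<^sub>R ?b = P ?b + Q ?b" by (simp add: P_def Q_def scaleR_2)
    then have "2 *\<^sub>R (P ^^ i) ?b = (P ^^ i) (P ?b + Q ?b)"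
      using linear_map_on_scaleR[OF P_pow Q_pow_H, of i 2 j] by simp
    then have "2 *\<^sub>R (P ^^ i) ?b = (P ^^ i) (P ?b) + (P ^^ i) (Q ?b)"
      using linear_map_on_add[OF P_pow H] by simp
    from fun_cong[OF this, of x] show ?thesis
      by (simp add: v_def funpow_swap1)
  qed
  moreover have "\<bar>v i j\<bar> \<le> sup_norm X a" for i j
    using bound[of i j x] sup_norm_nonneg[OF a] by (cases "x \<in> X") (auto simp: v_def)
  ultimately have "v (Suc 0) 0 = v 0 (Suc 0)" by (rule bounded_harmonic_eq)
  \<comment> \<open>\<open>v (Suc 0) 0\<close> and \<open>v 0 (Suc 0)\<close> are
    \<open>P a x\<close> and \<open>Q a x\<close>, which differ by \<open>2 / r\<close> times
    \<open>T a x - U a x\<close>.\<close>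
  then show "T a x = U a x" using \<open>0 < r\<close> by (simp add: v_def P_def Q_def)
qed

end

section \<open>Determination by extreme points, multiplication operators and the equivalence\<close>

locale determined_intermediate_space = nonempty_intermediate_space +
  assumes determined: "determined_by_extreme_points X H"
begin

lemma ext_subset: "x \<in> ext X \<Longrightarrow> x \<in> X"
  by (simp add: ext_def extreme_point_of_def)

text \<open>If there were no extreme points, all constants would be bounded by the junk value \<open>Sup {}\<close>.\<close>
lemma ext_nonempty: "ext X \<noteq> {}"
proof
  assume "ext X = {}"
  obtain x where "x \<in> X" using nonempty by blast
  let ?u = "(Sup {} + 1) *\<^sub>R indicator X :: 'a \<Rightarrow> real"
  have "?u \<in> H" by simp
  then have "?u x \<le> Sup (?u ` ext X)"
    using determined \<open>x \<in> X\<close> unfolding determined_by_extreme_points_def by blast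
  then show False using \<open>ext X = {}\<close> \<open>x \<in> X\<close> by simp
qed

text \<open>A minimum principle: \<open>u\<close> is bounded below by its infimum over
  \<open>ext X\<close>, a genuine infimum by \<open>ext_nonempty\<close>.\<close>

lemma nonneg_if_nonneg_ext:
  assumes "u \<in> H" "\<And>x. x \<in> ext X \<Longrightarrow> 0 \<le> u x"
  shows "0 \<le> u"
proof (rule le_funI)
  fix x
  show "0 x \<le> u x"
  proof (cases "x \<in> X")
    case True
    have "0 \<le> Inf (u ` ext X)" using assms(2) ext_nonempty by (intro cInf_greatest) auto
    also have "\<dots> \<le> u x"
      using determined True assms(1) by (simp add: determined_by_extreme_points_def)
    finally show ?thesis by simp
  qed (simp add: H_outside assms(1))
qed

text \<open>Makes the product of a multiplier with \<open>a\<close>, as an element of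
  \<open>H\<close>, unique.\<close>

lemma eq_if_eq_ext:
  assumes "u \<in> H" "v \<in> H" "\<And>x. x \<in> ext X \<Longrightarrow> u x = v x"
  shows "u = v"
proof (rule antisym)
  have "0 \<le> v - u" by (rule nonneg_if_nonneg_ext) (use assms in auto)
  moreover have "0 \<le> u - v" by (rule nonneg_if_nonneg_ext) (use assms in auto)
  ultimately show "u \<le> v" "v \<le> u" by (simp_all add: le_fun_def)
qed

text \<open>\<open>U a\<close> is the element of \<open>H\<close> that equals \<open>u * a\<close>
  on \<open>ext X\<close>. Uniqueness gives linearity, and the inequalities, clear on
  \<open>ext X\<close>, extend to \<open>X\<close> by \<open>nonneg_if_nonneg_ext\<close>.\<close>

lemma multiplication_operator:
  assumes u: "u \<in> multipliers X H"
  obtains U where "U \<in> center_operators (sup_norm X) H" "U (indicator X) = u"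
    "\<And>a x. a \<in> H \<Longrightarrow> x \<in> ext X \<Longrightarrow> U a x = u x * a x"
proof -
  have "u \<in> H" and "\<forall>a\<in>H. \<exists>b. b \<in> H \<and> (\<forall>x\<in>ext X. b x = u x * a x)"
    using u by (auto simp: multipliers_def)
  from this(2) obtain U where U: "\<And>a. a \<in> H \<Longrightarrow> U a \<in> H"
    "\<And>a x. a \<in> H \<Longrightarrow> x \<in> ext X \<Longrightarrow> U a x = u x * a x"
    unfolding bchoice_iff by blast
  let ?c = "sup_norm X u"
  have "linear_map_on H U"
    unfolding linear_map_on_def by (auto intro!: eq_if_eq_ext simp: U algebra_simps)
  moreover have "sup_norm X (U a) \<le> ?c * sup_norm X a" if a: "a \<in> H" for a
  proof -
    let ?d = "?c * sup_norm X a"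
    have ext: "\<bar>U a x\<bar> \<le> ?d" if "x \<in> ext X" for x
      using a that \<open>u \<in> H\<close>
      by (simp add: U(2) abs_mult mult_mono abs_le_sup_norm sup_norm_nonneg)
    have "0 \<le> ?d *\<^sub>R indicator X - U a"
      by (rule nonneg_if_nonneg_ext) (use ext a ext_subset in \<open>simp_all add: U(1) abs_le_iff\<close>)
    moreover have "0 \<le> ?d *\<^sub>R indicator X + U a"
    proof (rule nonneg_if_nonneg_ext)
      fix x assume "x \<in> ext X"
      then show "0 \<le> (?d *\<^sub>R indicator X + U a) x"
        using ext[of x] ext_subset[of x] by (simp add: abs_le_iff)
    qed (simp add: U(1) a)
    ultimately have nonneg: "0 \<le> (?d *\<^sub>R indicator X - U a) x" "0 \<le> (?d *\<^sub>R indicator X + U a) x" for x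
      by (simp_all only: le_fun_def zero_fun_apply)
    have "\<bar>U a x\<bar> \<le> ?d * indicator X x" for x using nonneg[of x] by (simp add: abs_le_iff)
    then show ?thesis by (intro sup_norm_le) (metis indicator_simps(1) mult.right_neutral)
  qed
  \<comment> \<open>The norm \<open>?c\<close> of \<open>u\<close> is the order bound of the
    operator, since \<open>?c + u\<close> and \<open>?c - u\<close> are nonnegative on
    \<open>ext X\<close>.\<close>
  moreover have "0 \<le> U a + ?c *\<^sub>R a" "0 \<le> ?c *\<^sub>R a - U a" if a: "a \<in> H" "0 \<le> a" for a
  proof -
    have "0 \<le> (u x + ?c) * a x" "0 \<le> (?c - u x) * a x" for x
      using a(2) abs_le_sup_norm[OF \<open>u \<in> H\<close>, of x] by (auto simp: le_fun_def abs_le_iff)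
    then have "0 \<le> (U a + ?c *\<^sub>R a) x" "0 \<le> (?c *\<^sub>R a - U a) x" if "x \<in> ext X" for x
      using that a(1) by (simp_all add: U(2) distrib_right left_diff_distrib)
    then show "0 \<le> U a + ?c *\<^sub>R a" "0 \<le> ?c *\<^sub>R a - U a"
      using a(1) U(1) by (blast intro: nonneg_if_nonneg_ext H_combine)+
  qed
  ultimately have "U \<in> center_operators (sup_norm X) H"
    using U(1) sup_norm_nonneg[OF \<open>u \<in> H\<close>]
    by (auto simp: center_operators_def nonneg_operator_def intro!: exI[of _ ?c])
  moreover have "U (indicator X) = u"
    using \<open>u \<in> H\<close> ext_subset by (intro eq_if_eq_ext) (auto simp: U)
  ultimately show thesis using that U(2) by blast
qed

lemma multipliers_subset_center: "multipliers X H \<subseteq> center X H"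
  using multiplication_operator unfolding center_def by blast

text \<open>Multiplication by \<open>T (indicator X)\<close> is a central operator with the same
  value at \<open>indicator X\<close>, so it is \<open>T\<close> by
  \<open>center_operators_eqI\<close>.\<close>

lemma center_operator_eq_mult:
  assumes T: "T \<in> center_operators (sup_norm X) H" and mult: "T (indicator X) \<in> multipliers X H"
    and a: "a \<in> H" and x: "x \<in> ext X"
  shows "T a x = T (indicator X) x * a x"
proof -
  obtain U where U: "U \<in> center_operators (sup_norm X) H" "U (indicator X) = T (indicator X)"
    "\<And>a x. a \<in> H \<Longrightarrow> x \<in> ext X \<Longrightarrow> U a x = T (indicator X) x * a x"
    using multiplication_operator[OF mult] by blast
  have "T a = U a" using center_operators_eqI[OF T U(1)] U(2) a by simp
  with U(3)[OF a x] show ?thesis by simp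
qed

text \<open>Conjugation turns the identity that defines \<open>m_set S\<close>, taken at
  \<open>evaluation H x\<close>, into \<open>T a x = T (indicator X) x * a x\<close>.\<close>

theorem center_eq_multipliers_iff:
  "center X H = multipliers X H \<longleftrightarrow> evaluation H ` ext X \<subseteq> m_set S"
proof
  assume eq: "center X H = multipliers X H"
  have "T f (evaluation H x) = T (indicator S) (evaluation H x) * f (evaluation H x)"
    if x: "x \<in> ext X" and T: "T \<in> center_operators (sup_norm S) (A_c S)" and f: "f \<in> A_c S" for x T f
  proof -
    let ?T = "\<lambda>a. from_states (T (to_states a))"
    have T': "?T \<in> center_operators (sup_norm X) H"
      using T by (rule center_operators_from_states)
    then have "?T (indicator X) \<in> multipliers X H"
      unfolding eq[symmetric] by (rule center_memI)
    from center_operator_eq_mult[OF T' this from_states_H[OF f] x] show ?thesis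
      using ext_subset[OF x] by (simp add: to_from_states f to_states_one) (simp add: from_states_def)
  qed
  then show "evaluation H ` ext X \<subseteq> m_set S"
    by (auto simp: m_set_def evaluation_state ext_subset)
next
  assume m: "evaluation H ` ext X \<subseteq> m_set S"
  have "T (indicator X) \<in> multipliers X H" if T: "T \<in> center_operators (sup_norm X) H" for T
  proof -
    have "T a x = T (indicator X) x * a x" if a: "a \<in> H" and x: "x \<in> ext X" for a x
    proof -
      have "evaluation H x \<in> m_set S" using m x by blast
      with center_operators_to_states[OF T] to_states_A_c[OF a]
      have "to_states (T (from_states (to_states a))) (evaluation H x) =
          to_states (T (from_states (indicator S))) (evaluation H x) * to_states a (evaluation H x)"
        by (auto simp: m_set_def)
      then show ?thesis
        using center_operatorsD(1)[OF T] a x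
        by (simp add: from_to_states flip: to_states_one)
          (simp add: to_states_def evaluation_state ext_subset)
    qed
    moreover have "T a \<in> H" if "a \<in> H" for a using T that by (rule center_operatorsD(1))
    \<comment> \<open>The witness is \<open>T a\<close>.\<close>
    ultimately have "\<exists>b\<in>H. \<forall>x\<in>ext X. b x = T (indicator X) x * a x" if "a \<in> H" for a
      using that by blast
    then show ?thesis
      using center_operatorsD(1)[OF T one_H] by (simp add: multipliers_def)
  qed
  then have "center X H \<subseteq> multipliers X H" by (auto simp: center_def)
  with multipliers_subset_center show "center X H = multipliers X H" by blast
qed

end

text \<open>Here \<open>H\<close> contains only \<open>0\<close>, so both sides are
  \<open>{0}\<close>; the identity operator shows that the center is inhabited.\<close>

lemma center_empty:
  assumes "intermediate_function_space {} H"
  shows "center {} H = multipliers {} H"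
proof -
  have "subspace H" "H \<subseteq> A_b {}" using assms by (auto simp: intermediate_function_space_def)
  then have H: "H = {0}"
    by (auto simp: A_b_def affine_functions_def fun_eq_iff dest: subspace_0)
  have "(\<lambda>a. a) \<in> center_operators (sup_norm {}) {0 :: 'a \<Rightarrow> real}"
    by (auto simp: center_operators_def linear_map_on_def nonneg_operator_def intro: exI[of _ 1])
  moreover have "(indicator {} :: 'a \<Rightarrow> real) = 0" by (simp add: fun_eq_iff)
  ultimately have "center {} H = {0}" unfolding H center_def
    by (auto simp: center_operators_def)
  then show ?thesis by (simp add: H multipliers_def)
qed

theorem proposition4p7:
  fixes X :: "'a::locally_convex_tvs set" and H :: "('a \<Rightarrow> real) set"
  assumes "compact_convex X"
    and "intermediate_function_space X H"
    and "determined_by_extreme_points X H"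
  shows "center X H = multipliers X H \<longleftrightarrow>
         evaluation H ` ext X \<subseteq> m_set (state_space X H)"
proof (cases "X = {}")
  case True
  then have "ext X = {}" by (simp add: ext_def extreme_point_of_def)
  moreover have "center X H = multipliers X H" using True assms(2) center_empty by blast
  ultimately show ?thesis by simp
next
  case False
  interpret determined_intermediate_space X H
    by unfold_locales (use assms False in auto)
  show ?thesis by (rule center_eq_multipliers_iff)
qed

end
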